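(* Let $u\in H^\infty+C$ be unimodular and let $p$ be a real polynomial with positive leading coefficient satisfying $p(-x)=-p(x)$. Then $e^{ip}u$ is not invertible in $H^\infty+C$, i.e. $e^{-ip}\bar u\notin H^\infty+C$.
   Context: $H^\infty$: bounded analytic functions in the upper half-plane, identified with boundary values on $\mathbb R$; $C$: continuous functions on $\mathbb R$ with finite limits at $\pm\infty$ that coincide; $H^\infty+C=\{h+g:h\in H^\infty,g\in C\}$, a closed subalgebra of $L^\infty(\mathbb R)$. A function $f\in H^\infty+C$ is invertible in $H^\infty+C$ if $1/f\in H^\infty+C$. *)

theory Defs
  imports "HOL-Analysis.Analysis" "HOL-Computational_Algebra.Polynomial"
begin

text \<open>Functions on the real line are identified with boundary functions; equality in
L-infinity is equality almost everywhere w.r.t. Lebesgue measure.\<close>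

definition Linf :: "(real \<Rightarrow> complex) \<Rightarrow> bool" where
  "Linf f \<longleftrightarrow> f \<in> borel_measurable lborel \<and> (\<exists>B. AE x in lborel. norm (f x) \<le> B)"

definition Hinf :: "(real \<Rightarrow> complex) \<Rightarrow> bool" where
  "Hinf f \<longleftrightarrow> Linf f \<and>
     (\<exists>F. F holomorphic_on {z. Im z > 0} \<and> bounded (F ` {z. Im z > 0}) \<and>
          (AE x in lborel. ((\<lambda>y. F (Complex x y)) \<longlongrightarrow> f x) (at_right 0)))"

definition Cdot :: "(real \<Rightarrow> complex) \<Rightarrow> bool" where
  "Cdot g \<longleftrightarrow> continuous_on UNIV g \<and> (\<exists>L. (g \<longlongrightarrow> L) at_top \<and> (g \<longlongrightarrow> L) at_bot)"

definition HinfC :: "(real \<Rightarrow> complex) \<Rightarrow> bool" where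
  "HinfC f \<longleftrightarrow> f \<in> borel_measurable lborel \<and>
     (\<exists>h g. Hinf h \<and> Cdot g \<and> (AE x in lborel. f x = h x + g x))"

definition invertible_HinfC :: "(real \<Rightarrow> complex) \<Rightarrow> bool" where
  "invertible_HinfC f \<longleftrightarrow> HinfC f \<and> HinfC (\<lambda>x. 1 / f x)"

end

theory Submission
  imports Defs "HOL-Complex_Analysis.Cauchy_Integral_Theorem" "HOL-Probability.Sinc_Integral"
begin

text \<open>
If both \<open>u\<close> and \<open>v = exp(-ip) / u\<close> lie in \<open>HinfC\<close>, then, the continuous parts being
asymptotically constant, \<open>exp(-ip) = uv\<close> is asymptotic at \<open>+\<infinity>\<close> to the boundary function \<open>f\<close>
of a bounded holomorphic function on the upper half-plane. Zooming in at \<open>x = n\<close> on the scale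
\<open>1/p'(n)\<close> linearises \<open>p\<close>, so that \<open>exp(i p(n)) f(n + s/p'(n))\<close> tends boundedly to
\<open>exp(-is)\<close>. By Cauchy's theorem each of these functions of \<open>s\<close> integrates to zero against the
boundary values of \<open>((exp(iz) - 1)/z)^2\<close>, hence so does \<open>exp(-is)\<close>; but the product of the
two is \<open>(2 cos s - 2)/s^2\<close>, which is nonpositive and not null.
\<close>

section \<open>Preliminaries on Lebesgue measure\<close>

lemma integrable_const_over_1_plus_square:
  fixes C :: real
  shows "integrable lborel (\<lambda>t. C / (1 + t\<^sup>2))"
  using integrable_inverse_1_plus_square
  by (simp add: set_integrable_def einterval_def divide_inverse)

text \<open>The preimage of a null set under a nonconstant affine map is null. This carries
  almost-everywhere statements over to zoomed variables.\<close>

lemma AE_lborel_affine: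
  fixes P :: "real \<Rightarrow> bool"
  assumes "AE x in lborel. P x" "c \<noteq> 0"
  shows "AE x in lborel. P (t + c * x)"
proof -
  obtain N where N: "N \<in> null_sets lborel" "{x. \<not> P x} \<subseteq> N"
    using assms(1) by (auto elim!: AE_E simp: null_sets_def)
  have "AE x in lborel. t + c * x \<notin> N"
    using N(1) assms(2) by (intro AE_borel_affine AE_not_in) (auto simp: null_sets_def)
  then show ?thesis
    using N(2) by (auto elim!: eventually_mono)
qed

section \<open>Cauchy's theorem in the upper half-plane\<close>

text \<open>By Cauchy's theorem the bottom side of a rectangle can be traded for the other three
  sides. These have total length 4R and stay at distance at least R from 0, where \<open>G\<close>
  is at most C/R^2. Cauchy's theorem enters through a primitive \<open>\<Phi>\<close> on the convex
  half-plane.\<close>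

lemma upper_half_plane_holomorphic_integral_bound:
  assumes hol: "G holomorphic_on {z. Im z > 0}"
    and bd: "\<And>z. Im z > 0 \<Longrightarrow> norm (G z) \<le> C / (1 + (norm z)\<^sup>2)"
    and "\<epsilon> > 0" "R > 0"
  shows "norm (\<integral>t. indicator {-R..R} t *\<^sub>R G (Complex t \<epsilon>) \<partial>lborel) \<le> 4 * C / R"
proof -
  let ?S = "{z. Im z > 0}"
  have S: "convex ?S" "open ?S"
    by (simp_all add: convex_halfspace_Im_gt open_halfspace_Im_gt)
  then obtain \<Phi> where \<Phi>: "\<And>z. z \<in> ?S \<Longrightarrow> (\<Phi> has_field_derivative G z) (at z within ?S)"
    using holomorphic_convex_primitive' hol by blast
  then have \<Phi>': "(\<Phi> has_field_derivative G z) (at z)" if "Im z > 0" for z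
    using that at_within_open[OF _ S(2)] by force
  have contG: "continuous_on ?S G"
    using hol by (rule holomorphic_on_imp_continuous_on)
  \<comment> \<open>Evaluating the bound at the single point i already forces \<open>C\<close> to be
    nonnegative.\<close>
  have "C / (1 + (norm \<i>)\<^sup>2) \<ge> 0"
    using order_trans[OF norm_ge_zero bd[of \<i>]] by simp
  then have C: "C \<ge> 0" by simp
  have far: "norm (G z) \<le> C / R\<^sup>2" if "Im z > 0" "norm z \<ge> R" for z
  proof -
    have "R\<^sup>2 \<le> (norm z)\<^sup>2" using that \<open>R > 0\<close> by (simp add: power_mono)
    then have "C / (1 + (norm z)\<^sup>2) \<le> C / R\<^sup>2"
      using \<open>R > 0\<close> C by (intro divide_left_mono) (auto intro!: mult_pos_pos add_pos_nonneg add_increasing)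
    then show ?thesis using bd[OF that(1)] by simp
  qed
  have diff: "norm (\<Phi> a - \<Phi> b) \<le> C / R\<^sup>2 * norm (a - b)"
    if "\<And>z. z \<in> closed_segment a b \<Longrightarrow> Im z > 0 \<and> norm z \<ge> R" for a b
    using that by (intro field_differentiable_bound[where S = "closed_segment a b" and f' = G])
      (auto intro!: far has_field_derivative_at_within[OF \<Phi>'])
  \<comment> \<open>Corners of the rectangle, counterclockwise from the lower right to the lower
    left, with bottom side at height \<open>\<epsilon>\<close>.\<close>
  define A where "A = Complex R \<epsilon>"
  define B where "B = Complex R (\<epsilon> + R)"
  define D where "D = Complex (-R) (\<epsilon> + R)"
  define E where "E = Complex (-R) \<epsilon>"
  \<comment> \<open>On the vertical sides the real part is R or -R; on the top side the imaginary
    part is \<open>\<epsilon> + R\<close>.\<close>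
  have segs: "Im z > 0 \<and> norm z \<ge> R"
    if "z \<in> closed_segment A B \<union> closed_segment B D \<union> closed_segment D E" for z
  proof -
    have "Im z > 0 \<and> (\<bar>Re z\<bar> \<ge> R \<or> \<bar>Im z\<bar> \<ge> R)"
      using that \<open>R > 0\<close> \<open>\<epsilon> > 0\<close> unfolding A_def B_def D_def E_def
      by (auto simp: closed_segment_same_Re closed_segment_same_Im closed_segment_eq_real_ivl split: if_splits)
    then show ?thesis
      using abs_Re_le_cmod[of z] abs_Im_le_cmod[of z] by linarith
  qed
  have nrm: "norm (A - B) = R" "norm (B - D) = 2 * R" "norm (D - E) = R"
    using \<open>R > 0\<close> by (simp_all add: A_def B_def D_def E_def cmod_def real_sqrt_mult)
  have "norm (\<Phi> A - \<Phi> E) \<le> norm (\<Phi> A - \<Phi> B) + norm (\<Phi> B - \<Phi> D) + norm (\<Phi> D - \<Phi> E)"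
    by (smt (verit) norm_triangle_ineq diff_add_cancel add_diff_eq diff_add_eq)
  also have "\<dots> \<le> C / R\<^sup>2 * R + C / R\<^sup>2 * (2 * R) + C / R\<^sup>2 * R"
    using diff[of A B] diff[of B D] diff[of D E] segs by (intro add_mono) (auto simp: nrm)
  also have "\<dots> = 4 * C / R"
    using \<open>R > 0\<close> by (simp add: power2_eq_square field_simps)
  finally have main: "norm (\<Phi> A - \<Phi> E) \<le> 4 * C / R" .
  have "(\<integral>t. indicator {-R..R} t *\<^sub>R G (Complex t \<epsilon>) \<partial>lborel)
      = \<Phi> (Complex R \<epsilon>) - \<Phi> (Complex (-R) \<epsilon>)"
  proof (rule integral_FTC_Icc[where F = "\<lambda>t. \<Phi> (Complex t \<epsilon>)"])
    show "-R \<le> R" using \<open>R > 0\<close> by simp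
    have line: "((\<lambda>t. Complex t \<epsilon>) has_vector_derivative 1) (at t within T)" for t T
      by (auto simp: Complex_eq intro!: derivative_eq_intros)
    show "((\<lambda>t. \<Phi> (Complex t \<epsilon>)) has_vector_derivative G (Complex t \<epsilon>)) (at t within {-R..R})" for t
      using field_vector_diff_chain_within[OF line has_field_derivative_at_within[OF \<Phi>'[of "Complex t \<epsilon>"]], of "{-R..R}"] \<open>\<epsilon> > 0\<close>
      by (simp add: o_def)
    show "continuous_on {-R..R} (\<lambda>t. G (Complex t \<epsilon>))"
      by (rule continuous_on_compose2[OF contG])
        (use \<open>\<epsilon> > 0\<close> in \<open>auto simp: Complex_eq intro!: continuous_intros\<close>)
  qed
  then show ?thesis using main by (simp add: A_def E_def)
qed

text \<open>Integrate over [-R, R] at height 1/R with R = n + 1. The rectangle bound 4C/R tends to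
  0, while dominated convergence sends the same integrals to that of \<open>g\<close>. The majorant
  C/(1 + t^2) serves every height because a point above t has modulus at least |t|.\<close>

lemma upper_half_plane_boundary_integral_eq_0:
  assumes hol: "G holomorphic_on {z. Im z > 0}"
    and bd: "\<And>z. Im z > 0 \<Longrightarrow> norm (G z) \<le> C / (1 + (norm z)\<^sup>2)"
    and [measurable]: "g \<in> borel_measurable lborel"
    and lim: "AE t in lborel. ((\<lambda>y. G (Complex t y)) \<longlongrightarrow> g t) (at_right 0)"
  shows "(\<integral>t. g t \<partial>lborel) = 0"
proof -
  define \<epsilon> where "\<epsilon> n = inverse (real (Suc n))" for n
  have \<epsilon>: "\<epsilon> n > 0" for n by (simp add: \<epsilon>_def)
  have \<epsilon>_lim: "filterlim \<epsilon> (at_right 0) sequentially"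
    unfolding filterlim_at using LIMSEQ_inverse_real_of_nat
    by (auto simp: \<epsilon>_def[abs_def])
  define I where "I n = (\<integral>t. indicator {-real (Suc n)..real (Suc n)} t *\<^sub>R G (Complex t (\<epsilon> n)) \<partial>lborel)" for n
  have contG: "continuous_on {z. Im z > 0} G"
    using hol by (rule holomorphic_on_imp_continuous_on)
  have "C / (1 + (norm \<i>)\<^sup>2) \<ge> 0"
    using order_trans[OF norm_ge_zero bd[of \<i>]] by simp
  then have C: "C \<ge> 0" by simp
  have "I \<longlonglongrightarrow> (\<integral>t. g t \<partial>lborel)"
    unfolding I_def
  proof (rule integral_dominated_convergence)
    show "integrable lborel (\<lambda>t. C / (1 + t\<^sup>2))"
      by (rule integrable_const_over_1_plus_square)
    show "(\<lambda>t. indicator {-real (Suc n)..real (Suc n)} t *\<^sub>R G (Complex t (\<epsilon> n))) \<in> borel_measurable lborel" for n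
    proof -
      have "continuous_on UNIV (\<lambda>t. G (Complex t (\<epsilon> n)))"
        by (rule continuous_on_compose2[OF contG])
          (use \<epsilon> in \<open>auto simp: Complex_eq intro!: continuous_intros\<close>)
      then have [measurable]: "(\<lambda>t. G (Complex t (\<epsilon> n))) \<in> borel_measurable borel"
        by (rule borel_measurable_continuous_onI)
      show ?thesis by measurable
    qed
    show "AE t in lborel. (\<lambda>n. indicator {-real (Suc n)..real (Suc n)} t *\<^sub>R G (Complex t (\<epsilon> n))) \<longlonglongrightarrow> g t"
      using lim
    proof eventually_elim
      case (elim t)
      have "(\<lambda>n. G (Complex t (\<epsilon> n))) \<longlonglongrightarrow> g t"
        using filterlim_compose[OF elim \<epsilon>_lim] .
      \<comment> \<open>Once n is at least |t|, the truncation no longer affects the point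
        t.\<close>
      moreover have "\<forall>\<^sub>F n in sequentially. G (Complex t (\<epsilon> n))
          = indicator {-real (Suc n)..real (Suc n)} t *\<^sub>R G (Complex t (\<epsilon> n))"
        using eventually_ge_at_top[of "nat \<lceil>\<bar>t\<bar>\<rceil>"]
        by eventually_elim (auto simp: indicator_def)
      ultimately show ?case by (rule Lim_transform_eventually)
    qed
    show "AE t in lborel. norm (indicator {-real (Suc n)..real (Suc n)} t *\<^sub>R G (Complex t (\<epsilon> n))) \<le> C / (1 + t\<^sup>2)" for n
    proof (rule AE_I2)
      fix t
      have "norm (G (Complex t (\<epsilon> n))) \<le> C / (1 + (norm (Complex t (\<epsilon> n)))\<^sup>2)"
        using \<epsilon> by (intro bd) simp
      also have "\<dots> \<le> C / (1 + t\<^sup>2)"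
        using C by (intro divide_left_mono) (auto intro!: mult_pos_pos add_pos_nonneg simp: cmod_power2)
      finally show "norm (indicator {-real (Suc n)..real (Suc n)} t *\<^sub>R G (Complex t (\<epsilon> n))) \<le> C / (1 + t\<^sup>2)"
        using C by (auto simp: indicator_def)
    qed
  qed simp
  moreover have "I \<longlonglongrightarrow> 0"
  proof (rule Lim_null_comparison)
    show "\<forall>\<^sub>F n in sequentially. norm (I n) \<le> 4 * C * inverse (real (Suc n))"
      using upper_half_plane_holomorphic_integral_bound[OF hol bd \<epsilon>, of "real (Suc _)"]
      unfolding I_def divide_inverse by (intro always_eventually allI) simp
    show "(\<lambda>n. 4 * C * inverse (real (Suc n))) \<longlonglongrightarrow> 0"
      by (rule tendsto_mult_right_zero[OF LIMSEQ_inverse_real_of_nat])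
  qed
  ultimately show ?thesis by (rule LIMSEQ_unique)
qed

section \<open>The test kernel and its pairing with exp(-is)\<close>

text \<open>The junk value \<open>0\<close> at \<open>z = 0\<close> is harmless: the singularity lies on the boundary of the
half-plane and is a null set there.\<close>

definition sinc_kernel :: "complex \<Rightarrow> complex" where
  "sinc_kernel z = ((exp (\<i> * z) - 1) / z)\<^sup>2"

text \<open>The derivative of exp(iw) has modulus at most 1 on the closed upper half-plane, which is
  convex, so exp(iw) is 1-Lipschitz there. The second bound is the triangle inequality.\<close>

lemma norm_exp_ii_minus_1_le:
  assumes "Im z \<ge> 0"
  shows "norm (exp (\<i> * z) - 1) \<le> norm z" "norm (exp (\<i> * z) - 1) \<le> 2"
proof -
  have e: "norm (exp (\<i> * w)) \<le> 1" if "Im w \<ge> 0" for w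
    using that by (simp add: norm_exp_eq_Re)
  have "norm (exp (\<i> * z) - exp (\<i> * 0)) \<le> 1 * norm (z - 0)"
    by (rule field_differentiable_bound[where S = "{w. Im w \<ge> 0}" and f' = "\<lambda>w. exp (\<i> * w) * \<i>"])
      (use assms in \<open>auto simp: convex_halfspace_Im_ge norm_mult intro!: derivative_eq_intros e\<close>)
  then show "norm (exp (\<i> * z) - 1) \<le> norm z" by simp
  show "norm (exp (\<i> * z) - 1) \<le> 2"
    using norm_triangle_ineq4[of "exp (\<i> * z)" 1] e[OF assms] by (smt (verit) norm_one)
qed

text \<open>With e = |exp(iz) - 1| and r = |z|, adding e^2 <= r^2 and e^2 r^2 <= 4 r^2 gives e^2 (1
  + r^2) <= 5 r^2, whence the constant 5.\<close>

lemma norm_sinc_kernel_le: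
  assumes "Im z \<ge> 0"
  shows "norm (sinc_kernel z) \<le> 5 / (1 + (norm z)\<^sup>2)"
proof (cases "z = 0")
  case False
  define r where "r = norm z"
  define e where "e = norm (exp (\<i> * z) - 1)"
  have r: "r > 0" using False by (simp add: r_def)
  have e: "e\<^sup>2 \<le> r\<^sup>2" "e\<^sup>2 \<le> 2\<^sup>2"
    using norm_exp_ii_minus_1_le[OF assms] unfolding e_def r_def by (intro power_mono; simp)+
  have "e\<^sup>2 * r\<^sup>2 \<le> 2\<^sup>2 * r\<^sup>2"
    by (rule mult_right_mono[OF e(2)]) simp
  with e have "e\<^sup>2 * (1 + r\<^sup>2) \<le> 5 * r\<^sup>2"
    by (simp add: distrib_left)
  then have "e\<^sup>2 / r\<^sup>2 \<le> 5 / (1 + r\<^sup>2)"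
    using r by (simp add: field_simps add_pos_nonneg)
  then show ?thesis
    by (simp add: sinc_kernel_def e_def r_def norm_power norm_divide power_divide)
qed (simp add: sinc_kernel_def)

text \<open>Expanding the square leaves exp(is) + exp(-is) - 2 in the numerator. At s = 0 both sides
  are 0 by the convention for division.\<close>

lemma exp_times_sinc_kernel_of_real:
  "exp (- \<i> * of_real s) * sinc_kernel (of_real s) = of_real ((2 * cos s - 2) / s\<^sup>2)"
proof -
  have "exp (- \<i> * of_real s) * (exp (\<i> * of_real s) - 1)\<^sup>2 = exp (\<i> * of_real s) + exp (- \<i> * of_real s) - 2"
    by (simp add: power2_eq_square algebra_simps flip: exp_add)
  also have "\<dots> = of_real (2 * cos s - 2)"
    by (simp add: exp_Euler cos_of_real sin_of_real complex_eq_iff exp_minus)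
  finally show ?thesis
    by (simp add: sinc_kernel_def power_divide)
qed

text \<open>Up to sign the integrand is \<open>k\<close>, which away from 0 is the square of
  sin(s/2)/(s/2). A nonnegative function with integral 0 vanishes almost everywhere, but
  \<open>k\<close> is positive on (0, 1).\<close>

lemma sinc_kernel_integral_nonzero: "(\<integral>s. exp (- \<i> * of_real s) * sinc_kernel (of_real s) \<partial>lborel) \<noteq> 0"
proof
  assume 0: "(\<integral>s. exp (- \<i> * of_real s) * sinc_kernel (of_real s) \<partial>lborel) = 0"
  define k :: "real \<Rightarrow> real" where "k s = (2 - 2 * cos s) / s\<^sup>2" for s
  have [measurable]: "k \<in> borel_measurable borel" unfolding k_def by measurable
  have k: "exp (- \<i> * of_real s) * sinc_kernel (of_real s) = - of_real (k s)" for s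
    unfolding exp_times_sinc_kernel_of_real k_def by (simp add: minus_divide_left)
  have "norm (k s) \<le> 5 / (1 + s\<^sup>2)" for s
  proof -
    have "norm (k s) = norm (exp (- \<i> * of_real s) * sinc_kernel (of_real s))"
      unfolding k by simp
    also have "\<dots> \<le> 5 / (1 + s\<^sup>2)"
      using norm_sinc_kernel_le[of "of_real s"] by (simp add: norm_mult norm_exp_eq_Re)
    finally show ?thesis .
  qed
  \<comment> \<open>Integrability is essential here: the Bochner integral of a non-integrable
    function is 0 by convention, so a zero integral alone would say nothing.\<close>
  then have "integrable lborel k"
    by (intro Bochner_Integration.integrable_bound[OF integrable_const_over_1_plus_square[of 5]]) auto
  moreover have "(\<integral>s. k s \<partial>lborel) = 0"
    using 0 unfolding k by simp
  moreover have "k s \<ge> 0" for s by (simp add: k_def)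
  ultimately have "AE s in lborel. k s = 0"
    by (subst (asm) integral_nonneg_eq_0_iff_AE) auto
  then have "AE s in lborel. s \<notin> {0<..<1::real}"
  proof eventually_elim
    case (elim s)
    then show ?case
      using cos_monotone_0_pi[of 0 s] pi_gt3 by (auto simp: k_def)
  qed
  then have "emeasure lborel {0<..<1::real} = 0"
    by (subst (asm) AE_iff_measurable[of "{0<..<1}"]) auto
  then show False by simp
qed


section \<open>Linearising the polynomial at infinity\<close>

text \<open>Dividing a monomial of degree i by n^d leaves the factor (1/n)^(d-i), so only i = d
  survives in the limit.\<close>

lemma poly_over_power_tendsto:
  fixes q :: "real poly" and \<xi> :: "nat \<Rightarrow> real"
  assumes "degree q \<le> d" and \<xi>: "(\<lambda>n. \<xi> n / real n) \<longlonglongrightarrow> 1"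
  shows "(\<lambda>n. poly q (\<xi> n) / real n ^ d) \<longlonglongrightarrow> coeff q d"
proof -
  have "(\<lambda>n. \<Sum>i\<le>d. coeff q i * (\<xi> n / real n) ^ i * inverse (real n) ^ (d - i))
      \<longlonglongrightarrow> (\<Sum>i\<le>d. coeff q i * 1 ^ i * 0 ^ (d - i))"
    by (intro tendsto_intros \<xi> lim_inverse_n)
  also have "(\<Sum>i\<le>d. coeff q i * 1 ^ i * 0 ^ (d - i)) = (\<Sum>i\<le>d. if i = d then coeff q i else 0)"
    by (intro sum.cong) auto
  also have "\<dots> = coeff q d" by simp
  finally show ?thesis
  proof (rule Lim_transform_eventually)
    show "\<forall>\<^sub>F n in sequentially. (\<Sum>i\<le>d. coeff q i * (\<xi> n / real n) ^ i * inverse (real n) ^ (d - i))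
        = poly q (\<xi> n) / real n ^ d"
      using eventually_gt_at_top[of 0]
    proof eventually_elim
      case (elim n)
      have "coeff q i * (\<xi> n / real n) ^ i * inverse (real n) ^ (d - i) = coeff q i * \<xi> n ^ i / real n ^ d"
        if "i \<le> d" for i
        using elim that power_add[of "real n" i "d - i"] by (simp add: field_simps)
      moreover have "poly q (\<xi> n) = (\<Sum>i\<le>d. coeff q i * \<xi> n ^ i)"
        unfolding poly_altdef using assms(1)
        by (intro sum.mono_neutral_left) (auto simp: coeff_eq_0)
      ultimately show ?case
        by (simp add: sum_divide_distrib)
    qed
  qed
qed

text \<open>The scale \<open>\<mu> n\<close> is the leading term of p'(n). By the mean value theorem
  the increment is s p'(\<open>\<xi>\<close>)/\<open>\<mu> n\<close> with \<open>\<xi>\<close>/n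
  tending to 1, so the quotient p'(\<open>\<xi>\<close>)/\<open>\<mu> n\<close> tends to 1.\<close>

lemma poly_rescaled_increment_tendsto:
  fixes p :: "real poly"
  assumes "lead_coeff p > 0" "degree p = Suc d"
  defines "\<mu> \<equiv> \<lambda>n. real (Suc d) * lead_coeff p * real n ^ d"
  shows "(\<lambda>n. poly p (real n + s / \<mu> n) - poly p (real n)) \<longlonglongrightarrow> s"
proof -
  define a where "a = real (Suc d) * lead_coeff p"
  have a: "a > 0" using assms(1) by (simp add: a_def)
  have \<mu>: "\<mu> n = a * real n ^ d" for n by (simp add: \<mu>_def a_def)
  \<comment> \<open>The minimum and maximum allow for either sign of s.\<close>
  have "\<exists>\<xi>. \<xi> \<in> {min (real n) (real n + s / \<mu> n)..max (real n) (real n + s / \<mu> n)} \<and>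
      poly p (real n + s / \<mu> n) - poly p (real n) = s / \<mu> n * poly (pderiv p) \<xi>" for n
    using poly_MVT'[OF order_refl, of "real n" "real n + s / \<mu> n" p] by auto
  then obtain \<xi> where \<xi>: "\<And>n. \<xi> n \<in> {min (real n) (real n + s / \<mu> n)..max (real n) (real n + s / \<mu> n)}"
    and mvt: "\<And>n. poly p (real n + s / \<mu> n) - poly p (real n) = s / \<mu> n * poly (pderiv p) (\<xi> n)"
    by metis
  have "(\<lambda>n. \<xi> n / real n - 1) \<longlonglongrightarrow> 0"
  proof (rule Lim_null_comparison)
    show "\<forall>\<^sub>F n in sequentially. norm (\<xi> n / real n - 1) \<le> \<bar>s\<bar> / a * inverse (real n)"
      using eventually_gt_at_top[of 0]
    proof eventually_elim
      case (elim n)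
      have "\<bar>\<xi> n - real n\<bar> \<le> \<bar>s / \<mu> n\<bar>" using \<xi>[of n] unfolding atLeastAtMost_iff by linarith
      also have "\<dots> = \<bar>s\<bar> / \<mu> n" using a by (simp add: \<mu> abs_mult)
      \<comment> \<open>For n > 0 the power n^d is at least 1, so \<open>\<xi> n\<close> stays
        within a fixed distance of n.\<close>
      also have "\<dots> \<le> \<bar>s\<bar> / a"
        using a elim by (intro divide_left_mono) (auto simp: \<mu>)
      finally have "\<bar>\<xi> n - real n\<bar> / real n \<le> \<bar>s\<bar> / a / real n"
        by (rule divide_right_mono) simp
      moreover have "\<xi> n / real n - 1 = (\<xi> n - real n) / real n"
        using elim by (simp add: field_simps)
      ultimately show ?case by (simp add: divide_inverse abs_mult)
    qed
    show "(\<lambda>n. \<bar>s\<bar> / a * inverse (real n)) \<longlonglongrightarrow> 0"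
      by (rule tendsto_mult_right_zero[OF lim_inverse_n])
  qed
  then have "(\<lambda>n. \<xi> n / real n) \<longlonglongrightarrow> 1"
    by (simp add: LIM_zero_iff)
  then have "(\<lambda>n. poly (pderiv p) (\<xi> n) / real n ^ d) \<longlonglongrightarrow> coeff (pderiv p) d"
    by (intro poly_over_power_tendsto) (auto simp: degree_pderiv assms(2))
  also have "coeff (pderiv p) d = a"
    by (simp add: coeff_pderiv a_def assms(2))
  finally have "(\<lambda>n. s / a * (poly (pderiv p) (\<xi> n) / real n ^ d)) \<longlonglongrightarrow> s / a * a"
    by (intro tendsto_intros)
  then show ?thesis
    using a unfolding mvt unfolding \<mu> by simp
qed

section \<open>The zooming argument\<close>

text \<open>Positivity of the leading coefficient makes \<open>m n\<close> positive, so the zoom z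
  -> x n + z / m n preserves the upper half-plane. Each zoomed function times the kernel therefore
  has boundary integral 0, and dominated convergence passes this to the limit exp(-is) times the
  kernel, whose integral is not 0.\<close>

lemma no_bounded_holomorphic_boundary_asymptotic_to_exp_poly:
  fixes p :: "real poly"
  assumes hol: "F holomorphic_on {z. Im z > 0}"
    and bd: "\<And>z. Im z > 0 \<Longrightarrow> norm (F z) \<le> M"
    and [measurable]: "f \<in> borel_measurable borel"
    and lim: "AE t in lborel. ((\<lambda>y. F (Complex t y)) \<longlongrightarrow> f t) (at_right 0)"
    and asym: "AE t in lborel. norm (f t * exp (\<i> * of_real (poly p t)) - 1) \<le> k t"
    and k: "(k \<longlongrightarrow> 0) at_top"
    and p: "lead_coeff p > 0" "degree p > 0"
  shows False
proof -
  obtain d where d: "degree p = Suc d" using p(2) gr0_implies_Suc by blast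
  \<comment> \<open>The leading term of p' at n + 1; the shift by one keeps it positive at n = 0 as
    well.\<close>
  define m where "m n = real (Suc d) * lead_coeff p * real (Suc n) ^ d" for n
  define x where "x n = real (Suc n)" for n
  define c where "c n = exp (\<i> * of_real (poly p (x n)))" for n
  have m: "m n > 0" for n using p(1) by (simp add: m_def)
  have m0: "1 / m n \<noteq> 0" for n using m[of n] by simp
  have c: "norm (c n) = 1" for n by (simp add: c_def norm_exp_eq_Re)
  have M: "M \<ge> 0" using order_trans[OF norm_ge_zero bd[of \<i>]] by simp
  have sinc_kernel_meas [measurable]: "(\<lambda>s. sinc_kernel (of_real s)) \<in> borel_measurable borel"
    unfolding sinc_kernel_def by measurable
  have f_bd: "AE t in lborel. norm (f t) \<le> M"
    using lim
  proof eventually_elim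
    case (elim t)
    show ?case
      by (rule Lim_norm_ubound[OF _ elim])
        (auto intro!: bd eventually_mono[OF eventually_at_right_less])
  qed
  define g where "g n s = c n * f (x n + 1 / m n * s) * sinc_kernel (of_real s)" for n s
  have g_int: "(\<integral>s. g n s \<partial>lborel) = 0" for n
  proof (rule upper_half_plane_boundary_integral_eq_0)
    let ?G = "\<lambda>z. c n * F (of_real (x n) + z / of_real (m n)) * sinc_kernel z"
    show "?G holomorphic_on {z. Im z > 0}"
      unfolding sinc_kernel_def using m[of n]
      by (intro holomorphic_intros holomorphic_on_compose_gen[OF _ hol, unfolded o_def]) auto
    show "norm (?G z) \<le> 5 * M / (1 + (norm z)\<^sup>2)" if "Im z > 0" for z
    proof -
      have "norm (?G z) = norm (F (of_real (x n) + z / of_real (m n))) * norm (sinc_kernel z)"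
        by (simp add: norm_mult c)
      also have "\<dots> \<le> M * (5 / (1 + (norm z)\<^sup>2))"
        using that m[of n] M by (intro mult_mono bd norm_sinc_kernel_le) auto
      finally show ?thesis by (simp add: mult.commute)
    qed
    show "g n \<in> borel_measurable lborel"
      unfolding g_def by measurable
    \<comment> \<open>The point s = 0 is discarded: there the kernel has value 0 by convention,
      whereas its limit is -1.\<close>
    show "AE s in lborel. ((\<lambda>y. ?G (Complex s y)) \<longlongrightarrow> g n s) (at_right 0)"
      using AE_lborel_affine[OF lim m0, of "x n" n] AE_lborel_singleton[of 0]
    proof eventually_elim
      case (elim s)
      have "filterlim (\<lambda>y. y / m n) (at_right 0) (at_right 0)"
        using m[of n] unfolding filterlim_at
        by (auto intro!: tendsto_eq_intros eventually_mono[OF eventually_at_right_less])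
      from filterlim_compose[OF elim(1) this]
      have "((\<lambda>y. F (Complex (x n + 1 / m n * s) (y / m n))) \<longlongrightarrow> f (x n + 1 / m n * s)) (at_right 0)" .
      moreover have "Complex (x n + 1 / m n * s) (y / m n) = of_real (x n) + Complex s y / of_real (m n)" for y
        by (simp add: complex_eq_iff)
      moreover have "((\<lambda>y. sinc_kernel (Complex s y)) \<longlongrightarrow> sinc_kernel (of_real s)) (at_right 0)"
        unfolding sinc_kernel_def Complex_eq using elim(2) by (auto intro!: tendsto_eq_intros)
      ultimately show ?case
        unfolding g_def by (auto intro!: tendsto_intros)
    qed
  qed
  have "(\<lambda>n. \<integral>s. g n s \<partial>lborel) \<longlonglongrightarrow> (\<integral>s. exp (- \<i> * of_real s) * sinc_kernel (of_real s) \<partial>lborel)"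
  proof (rule integral_dominated_convergence)
    show "integrable lborel (\<lambda>s. 5 * M / (1 + s\<^sup>2))"
      by (rule integrable_const_over_1_plus_square)
    show "g n \<in> borel_measurable lborel" for n
      unfolding g_def by measurable
    show "AE s in lborel. norm (g n s) \<le> 5 * M / (1 + s\<^sup>2)" for n
      using AE_lborel_affine[OF f_bd m0, of "x n" n]
    proof eventually_elim
      case (elim s)
      have "norm (f (x n + 1 / m n * s)) * norm (sinc_kernel (of_real s)) \<le> M * (5 / (1 + s\<^sup>2))"
        using norm_sinc_kernel_le[of "of_real s"] elim M by (intro mult_mono) auto
      then show ?case by (simp add: g_def norm_mult c mult.commute)
    qed
    \<comment> \<open>Countably many exceptional null sets are merged, so that almost every s works
      for all n at once.\<close>
    have "AE s in lborel. \<forall>n. norm (f (x n + 1 / m n * s) * exp (\<i> * of_real (poly p (x n + 1 / m n * s))) - 1)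
        \<le> k (x n + 1 / m n * s)"
      unfolding AE_all_countable by (intro allI AE_lborel_affine[OF asym m0])
    then show "AE s in lborel. (\<lambda>n. g n s) \<longlonglongrightarrow> exp (- \<i> * of_real s) * sinc_kernel (of_real s)"
    proof eventually_elim
      case (elim s)
      define t where "t n = x n + 1 / m n * s" for n
      have "filterlim t at_top sequentially"
      proof (rule filterlim_at_top_mono)
        show "filterlim (\<lambda>n. - (\<bar>s\<bar> / m 0) + real (Suc n)) at_top sequentially"
          by (intro filterlim_tendsto_add_at_top[OF tendsto_const]
              filterlim_compose[OF filterlim_real_sequentially filterlim_Suc])
        \<comment> \<open>Since \<open>m 0\<close> is the least of the \<open>m n\<close>, the shift
          s / m n is bounded uniformly in n.\<close>
        have "- (\<bar>s\<bar> / m 0) + real (Suc n) \<le> t n" for n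
        proof -
          have "\<bar>s / m n\<bar> \<le> \<bar>s\<bar> / m 0"
            using p(1) by (auto simp: m_def abs_mult intro!: divide_left_mono)
          moreover have "t n = real (Suc n) + s / m n"
            by (simp add: t_def x_def)
          ultimately show ?thesis by linarith
        qed
        then show "\<forall>\<^sub>F n in sequentially. - (\<bar>s\<bar> / m 0) + real (Suc n) \<le> t n"
          by (rule eventuallyI)
      qed
      then have "(\<lambda>n. k (t n)) \<longlonglongrightarrow> 0"
        by (rule filterlim_compose[OF k])
      then have "(\<lambda>n. f (t n) * exp (\<i> * of_real (poly p (t n))) - 1) \<longlonglongrightarrow> 0"
        by (rule Lim_null_comparison[rotated]) (use elim in \<open>simp add: t_def\<close>)
      then have A: "(\<lambda>n. f (t n) * exp (\<i> * of_real (poly p (t n)))) \<longlonglongrightarrow> 1"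
        by (simp add: LIM_zero_iff)
      have "(\<lambda>n. poly p (t n) - poly p (x n)) \<longlonglongrightarrow> s"
        using LIMSEQ_Suc[OF poly_rescaled_increment_tendsto[OF p(1) d, of s]]
        by (simp add: t_def x_def m_def)
      then have "(\<lambda>n. exp (- \<i> * of_real (poly p (t n) - poly p (x n)))) \<longlonglongrightarrow> exp (- \<i> * of_real s)"
        by (intro tendsto_intros)
      with A have "(\<lambda>n. f (t n) * exp (\<i> * of_real (poly p (t n)))
            * exp (- \<i> * of_real (poly p (t n) - poly p (x n))) * sinc_kernel (of_real s))
          \<longlonglongrightarrow> 1 * exp (- \<i> * of_real s) * sinc_kernel (of_real s)"
        by (intro tendsto_mult tendsto_const)
      \<comment> \<open>The phase at \<open>t n\<close> cancels, leaving the constant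
        \<open>c n\<close>; the three factors tend to 1, to exp(-is) and to the kernel
        value.\<close>
      moreover have "f (t n) * exp (\<i> * of_real (poly p (t n)))
            * exp (- \<i> * of_real (poly p (t n) - poly p (x n))) * sinc_kernel (of_real s) = g n s" for n
        unfolding g_def c_def t_def[symmetric]
        by (simp add: algebra_simps flip: exp_add)
      ultimately show ?case by simp
    qed
  qed simp
  then have "(\<integral>s. exp (- \<i> * of_real s) * sinc_kernel (of_real s) \<partial>lborel) = 0"
    by (simp add: g_int LIMSEQ_const_iff)
  with sinc_kernel_integral_nonzero show False by contradiction
qed

section \<open>Reduction from \<open>HinfC\<close> to bounded holomorphic functions\<close>

text \<open>The limit L of the continuous part at infinity is a constant, hence can be absorbed into
  the holomorphic part. What remains of the continuous part vanishes at infinity.\<close>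

lemma HinfC_decomposition_at_top:
  assumes "HinfC u"
  obtains F M h r where "F holomorphic_on {z. Im z > 0}"
    "\<And>z. Im z > 0 \<Longrightarrow> norm (F z) \<le> M"
    "h \<in> borel_measurable borel"
    "AE t in lborel. ((\<lambda>y. F (Complex t y)) \<longlongrightarrow> h t) (at_right 0)"
    "AE t in lborel. norm (h t) \<le> M"
    "AE t in lborel. u t = h t + r t"
    "(r \<longlongrightarrow> 0) at_top"
proof -
  obtain h g where hg: "Hinf h" "Cdot g" "AE t in lborel. u t = h t + g t"
    using assms by (auto simp: HinfC_def)
  obtain L where L: "(g \<longlongrightarrow> L) at_top"
    using hg(2) by (auto simp: Cdot_def)
  obtain F B where F: "F holomorphic_on {z. Im z > 0}" "bounded (F ` {z. Im z > 0})"
      "AE t in lborel. ((\<lambda>y. F (Complex t y)) \<longlongrightarrow> h t) (at_right 0)"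
    and h: "h \<in> borel_measurable lborel" "AE t in lborel. norm (h t) \<le> B"
    using hg(1) by (auto simp: Hinf_def Linf_def)
  obtain B' where B': "\<And>z. Im z > 0 \<Longrightarrow> norm (F z) \<le> B'"
    using F(2) by (auto simp: bounded_iff)
  \<comment> \<open>One constant bounds both the holomorphic function and its boundary values after
    the shift by L.\<close>
  define M where "M = max B B' + norm L"
  show thesis
  proof (rule that[of "\<lambda>z. F z + L" M "\<lambda>t. h t + L" "\<lambda>t. g t - L"])
    show "(\<lambda>z. F z + L) holomorphic_on {z. Im z > 0}"
      by (intro holomorphic_intros F)
    show "norm (F z + L) \<le> M" if "Im z > 0" for z
      using norm_triangle_ineq[of "F z" L] B'[OF that] by (simp add: M_def)
    show "(\<lambda>t. h t + L) \<in> borel_measurable borel"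
      using h(1) by simp
    show "AE t in lborel. ((\<lambda>y. F (Complex t y) + L) \<longlongrightarrow> h t + L) (at_right 0)"
      using F(3) by eventually_elim (intro tendsto_intros)
    show "AE t in lborel. norm (h t + L) \<le> M"
      using h(2)
    proof eventually_elim
      case (elim t)
      then show ?case using norm_triangle_ineq[of "h t" L] by (simp add: M_def)
    qed
    show "AE t in lborel. u t = h t + L + (g t - L)"
      using hg(3) by simp
    show "((\<lambda>t. g t - L) \<longlongrightarrow> 0) at_top"
      using L by (simp add: LIM_zero_iff)
  qed
qed

text \<open>Writing u = h1 + r1 and v = h2 + r2, the difference uv - h1 h2 equals h1 r2 + r1 (h2 +
  r2), which tends to 0 at infinity. So h1 h2, the boundary function of F1 F2, is asymptotic to
  exp(-ip).\<close>

lemma HinfC_product_ne_exp_poly: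
  fixes p :: "real poly"
  assumes "HinfC u" "HinfC v"
    and uv: "AE t in lborel. u t * v t = exp (- \<i> * of_real (poly p t))"
    and p: "lead_coeff p > 0" "degree p > 0"
  shows False
proof -
  obtain F1 M1 h1 r1 where 1: "F1 holomorphic_on {z. Im z > 0}"
    "\<And>z. Im z > 0 \<Longrightarrow> norm (F1 z) \<le> M1"
    "h1 \<in> borel_measurable borel"
    "AE t in lborel. ((\<lambda>y. F1 (Complex t y)) \<longlongrightarrow> h1 t) (at_right 0)"
    "AE t in lborel. norm (h1 t) \<le> M1" "AE t in lborel. u t = h1 t + r1 t"
    "(r1 \<longlongrightarrow> 0) at_top"
    using HinfC_decomposition_at_top[OF assms(1)] by blast
  obtain F2 M2 h2 r2 where 2: "F2 holomorphic_on {z. Im z > 0}"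
    "\<And>z. Im z > 0 \<Longrightarrow> norm (F2 z) \<le> M2"
    "h2 \<in> borel_measurable borel"
    "AE t in lborel. ((\<lambda>y. F2 (Complex t y)) \<longlongrightarrow> h2 t) (at_right 0)"
    "AE t in lborel. norm (h2 t) \<le> M2" "AE t in lborel. v t = h2 t + r2 t"
    "(r2 \<longlongrightarrow> 0) at_top"
    using HinfC_decomposition_at_top[OF assms(2)] by blast
  \<comment> \<open>The bound for the cross terms h1 r2 + r1 (h2 + r2), with |h1| and |h2| replaced
    by \<open>M1\<close> and \<open>M2\<close>.\<close>
  define k where "k t = M1 * norm (r2 t) + norm (r1 t) * (M2 + norm (r2 t))" for t
  have M1: "M1 \<ge> 0" using order_trans[OF norm_ge_zero 1(2)[of \<i>]] by simp
  show False
  proof (rule no_bounded_holomorphic_boundary_asymptotic_to_exp_poly)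
    show "(\<lambda>z. F1 z * F2 z) holomorphic_on {z. Im z > 0}"
      by (intro holomorphic_intros 1 2)
    show "norm (F1 z * F2 z) \<le> M1 * M2" if "Im z > 0" for z
      unfolding norm_mult using M1 by (intro mult_mono 1 2 that) auto
    show "(\<lambda>t. h1 t * h2 t) \<in> borel_measurable borel"
      using 1(3) 2(3) by measurable
    show "AE t in lborel. ((\<lambda>y. F1 (Complex t y) * F2 (Complex t y)) \<longlongrightarrow> h1 t * h2 t) (at_right 0)"
      using 1(4) 2(4) by eventually_elim (intro tendsto_intros)
    show "AE t in lborel. norm (h1 t * h2 t * exp (\<i> * of_real (poly p t)) - 1) \<le> k t"
      using uv 1(5,6) 2(5,6)
    proof eventually_elim
      case (elim t)
      define e where "e = exp (\<i> * of_real (poly p t))"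
      have e: "norm e = 1" "(h1 t + r1 t) * (h2 t + r2 t) * e = 1"
        using elim by (simp_all add: e_def norm_exp_eq_Re exp_minus)
      have "h1 t * h2 t * e - 1 = - ((h1 t * r2 t + r1 t * (h2 t + r2 t)) * e)"
        using e(2) by (simp add: algebra_simps)
      then have "norm (h1 t * h2 t * e - 1) = norm (h1 t * r2 t + r1 t * (h2 t + r2 t))"
        by (simp add: norm_mult e(1))
      also have "\<dots> \<le> norm (h1 t) * norm (r2 t) + norm (r1 t) * (norm (h2 t) + norm (r2 t))"
        by (intro norm_triangle_mono norm_mult_ineq order_trans[OF norm_mult_ineq] mult_left_mono norm_triangle_ineq) auto
      also have "\<dots> \<le> k t"
        unfolding k_def using elim M1 by (intro add_mono mult_mono mult_left_mono) auto
      finally show ?case by (simp add: e_def)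
    qed
    show "(k \<longlongrightarrow> 0) at_top"
      unfolding k_def using 1(7) 2(7) by (auto intro!: tendsto_eq_intros)
  qed (use p in auto)
qed

text \<open>Since |u| = 1, the inverse of exp(ip) u and the function exp(-ip) times the conjugate of
  u both have product exp(-ip) with u almost everywhere. Membership of either in
  \<open>HinfC\<close> would contradict the product lemma.\<close>

theorem theorem5p4:
  fixes u :: "real \<Rightarrow> complex" and p :: "real poly"
  assumes "HinfC u"
    and "AE x in lborel. norm (u x) = 1"
    and "lead_coeff p > 0"
    and "\<forall>x. poly p (- x) = - poly p x"
  shows "\<not> invertible_HinfC (\<lambda>x. exp (\<i> * of_real (poly p x)) * u x)
       \<and> \<not> HinfC (\<lambda>x. exp (- \<i> * of_real (poly p x)) * cnj (u x))"
proof -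
  \<comment> \<open>An odd constant polynomial is 0, which contradicts the positive leading
    coefficient.\<close>
  have "degree p > 0"
  proof (rule ccontr)
    assume "\<not> degree p > 0"
    then obtain a where "p = [:a:]" by (auto elim: degree_eq_zeroE)
    then show False using assms(3,4) by simp
  qed
  note contr = HinfC_product_ne_exp_poly[OF assms(1) _ _ assms(3) this]
  have "\<not> HinfC (\<lambda>x. 1 / (exp (\<i> * of_real (poly p x)) * u x))"
  proof
    assume "HinfC (\<lambda>x. 1 / (exp (\<i> * of_real (poly p x)) * u x))"
    moreover have "AE x in lborel. u x * (1 / (exp (\<i> * of_real (poly p x)) * u x)) = exp (- \<i> * of_real (poly p x))"
      using assms(2) by eventually_elim (auto simp: exp_minus field_simps)
    ultimately show False by (rule contr)
  qed
  moreover have "\<not> HinfC (\<lambda>x. exp (- \<i> * of_real (poly p x)) * cnj (u x))"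
  proof
    assume "HinfC (\<lambda>x. exp (- \<i> * of_real (poly p x)) * cnj (u x))"
    moreover have "AE x in lborel. u x * (exp (- \<i> * of_real (poly p x)) * cnj (u x)) = exp (- \<i> * of_real (poly p x))"
      using assms(2)
    proof eventually_elim
      case (elim x)
      then have "u x * cnj (u x) = 1" by (simp add: complex_norm_square[symmetric])
      then show ?case by (simp add: mult.left_commute)
    qed
    ultimately show False by (rule contr)
  qed
  ultimately show ?thesis by (simp add: invertible_HinfC_def)
qed

end
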